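(* Let $m,n$ be positive integers, $a,b$ non-negative integers with $a+b=n$ and $a$ even, and $x,y$ complex numbers with $ax+by=0$. Define \[ R_{1,3}(x,y;m,n;\tau)= mn\, i^{a}q^{\frac{a}{4}}\sum_{\substack{r_1,\ldots,r_a,s_1,\ldots,s_b\in\mathbb{Z}\\ 2(r_1+\cdots+r_a+s_1+\cdots+s_b)+a=0}}(-1)^{r_1+\cdots+r_a}q^{r_1^2+\cdots+r_a^2+s_1^2+\cdots+s_b^2+r_1+\cdots+r_a}e^{i(2(r_1+\cdots+r_a)x+2(s_1+\cdots+s_b)y+ax)}. \] Then for all $z\in\mathbb{C}$, \[ \sum_{k=0}^{mn-1}\vartheta_1^{a}\!\left(z+x+\tfrac{k\pi}{mn}\Big|\tau\right)\vartheta_3^{b}\!\left(z+y+\tfrac{k\pi}{mn}\Big|\tau\right)=R_{1,3}(x,y;m,n;\tau)\,\vartheta_3(mnz\,|\,m^2n\tau). \]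
   Context: Throughout, $\tau\in\mathbb{C}$ with $\Im(\tau)>0$, $q=e^{\pi i\tau}$, and $q^{\alpha}$ means $e^{\pi i\alpha\tau}$ for real $\alpha$. The Jacobi theta functions are $\vartheta_1(z|\tau)=-iq^{1/4}\sum_{n\in\mathbb{Z}}(-1)^nq^{n(n+1)}e^{(2n+1)iz}$ and $\vartheta_3(z|\tau)=\sum_{n\in\mathbb{Z}}q^{n^2}e^{2niz}$; $\vartheta_3(z|m^2n\tau)$ denotes $\vartheta_3$ with $\tau$ replaced by $m^2n\tau$. A zeroth power equals $1$. *)

theory Defs
  imports "HOL-Analysis.Analysis"
begin

text \<open>The power \<open>q\<^sup>\<alpha>\<close> of the nome \<open>q = exp (\<pi> i \<tau>)\<close>, fixed as \<open>exp (\<pi> i \<alpha> \<tau>)\<close>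
  so that no branch of the logarithm of \<open>q\<close> is involved.\<close>

definition nome_pow :: "complex \<Rightarrow> real \<Rightarrow> complex" where
  "nome_pow \<tau> \<alpha> = exp (of_real pi * \<i> * of_real \<alpha> * \<tau>)"

definition jtheta1 :: "complex \<Rightarrow> complex \<Rightarrow> complex" where
  "jtheta1 z \<tau> = - \<i> * nome_pow \<tau> (1/4) *
     (\<Sum>\<^sub>\<infinity>n\<in>(UNIV :: int set).
        (-1) powi n * nome_pow \<tau> (of_int (n * (n + 1))) * exp (of_int (2 * n + 1) * \<i> * z))"

definition jtheta3 :: "complex \<Rightarrow> complex \<Rightarrow> complex" where
  "jtheta3 z \<tau> =
     (\<Sum>\<^sub>\<infinity>n\<in>(UNIV :: int set). nome_pow \<tau> (of_int (n\<^sup>2)) * exp (of_int (2 * n) * \<i> * z))"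

text \<open>The tuples \<open>(r\<^sub>1, \<dots>, r\<^sub>a)\<close> and \<open>(s\<^sub>1, \<dots>, s\<^sub>b)\<close> are extensional functions on
  \<open>{1..a}\<close> and \<open>{1..b}\<close>; an empty index range contributes exactly one (empty) tuple.\<close>

definition R13_index :: "nat \<Rightarrow> nat \<Rightarrow> ((nat \<Rightarrow> int) \<times> (nat \<Rightarrow> int)) set" where
  "R13_index a b =
     {(r, s). r \<in> {1..a} \<rightarrow>\<^sub>E UNIV \<and> s \<in> {1..b} \<rightarrow>\<^sub>E UNIV \<and>
        2 * ((\<Sum>j=1..a. r j) + (\<Sum>j=1..b. s j)) + int a = 0}"

definition R13 ::
  "nat \<Rightarrow> nat \<Rightarrow> complex \<Rightarrow> complex \<Rightarrow> nat \<Rightarrow> nat \<Rightarrow> complex \<Rightarrow> complex" where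
  "R13 a b x y m n \<tau> =
     of_nat (m * n) * \<i> ^ a * nome_pow \<tau> (real a / 4) *
     (\<Sum>\<^sub>\<infinity>(r, s)\<in>R13_index a b.
        (-1) powi (\<Sum>j=1..a. r j) *
        nome_pow \<tau> (of_int ((\<Sum>j=1..a. (r j)\<^sup>2) + (\<Sum>j=1..b. (s j)\<^sup>2) + (\<Sum>j=1..a. r j))) *
        exp (\<i> * (of_int (2 * (\<Sum>j=1..a. r j)) * x + of_int (2 * (\<Sum>j=1..b. s j)) * y
                  + of_nat a * x)))"

end

theory Submission
  imports Defs
begin

text \<open>
  Expanding the product of theta powers gives a sum over tuples \<open>(r, s)\<close> in which \<open>z\<close> and \<open>k\<close> only
  enter through \<open>exp (2 i N (z + k \<pi> / (m n)))\<close>, where \<open>N = \<Sum>r + \<Sum>s + a / 2\<close>. Summing over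
  \<open>k\<close> kills all tuples except those with \<open>N = m n p\<close> for an integer \<open>p\<close>. Shifting each of the \<open>n\<close>
  entries of such a tuple by \<open>- m p\<close> yields a tuple with \<open>N = 0\<close>. Completing the square, the shift
  costs exactly the factor \<open>q ^ (m\<^sup>2 n p\<^sup>2)\<close>: the cross terms are multiples of \<open>N = 0\<close>
  and of \<open>a x + b y = 0\<close>. Hence the sum factors over \<open>(r, s)\<close> and \<open>p\<close>.
\<close>

text \<open>From here on \<open>abs_summable_on\<close> means the notion of absolute summability
  that goes with \<open>infsetsum\<close>, whose product rules over function spaces serve
  below.\<close>

no_notation Infinite_Sum.abs_summable_on (infixr \<open>abs'_summable'_on\<close> 46)

section \<open>Powers of the nome\<close>

lemma nome_pow_add: "nome_pow \<tau> (u + v) = nome_pow \<tau> u * nome_pow \<tau> v"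
  by (simp add: nome_pow_def ring_distribs flip: exp_add)

lemma nome_pow_0 [simp]: "nome_pow \<tau> 0 = 1"
  by (simp add: nome_pow_def)

lemma nome_pow_power: "nome_pow \<tau> u ^ k = nome_pow \<tau> (real k * u)"
  by (simp add: nome_pow_def mult_ac flip: exp_of_nat_mult)

lemma norm_nome_pow: "norm (nome_pow \<tau> u) = exp (- (pi * Im \<tau> * u))"
  by (simp add: nome_pow_def)

section \<open>Absolute convergence of Gaussian series over the integers\<close>

lemma summable_on_exp_minus_abs: "(\<lambda>n::int. exp (- real_of_int \<bar>n\<bar>)) summable_on UNIV"
proof -
  let ?f = "\<lambda>n::int. exp (- real_of_int \<bar>n\<bar>)"
  have geo: "(\<lambda>n::nat. exp (- real n)) summable_on UNIV"
  proof (subst summable_on_UNIV_nonneg_real_iff)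
    have "summable (\<lambda>n. exp (-1::real) ^ n)"
      by (rule summable_geometric) simp
    thus "summable (\<lambda>n. exp (- real n))"
      by (simp flip: exp_of_nat_mult)
  qed simp
  have "?f summable_on range int"
    by (subst summable_on_reindex) (use geo in \<open>simp_all add: o_def\<close>)
  moreover have "?f summable_on range (\<lambda>n. - int n)"
    by (subst summable_on_reindex) (use geo in \<open>simp_all add: o_def inj_on_def\<close>)
  \<comment> \<open>Zero lies in both ranges, so it is removed from one of them to make the union
    disjoint.\<close>
  then have "?f summable_on (range (\<lambda>n. - int n) - range int)"
    by (rule summable_on_subset_banach) auto
  ultimately have "?f summable_on (range int \<union> (range (\<lambda>n. - int n) - range int))"
    by (rule summable_on_Un_disjoint) auto
  moreover have "range int \<union> (range (\<lambda>n. - int n) - range int) = UNIV"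
    unfolding Un_Diff_cancel
    by (rule UNIV_eq_I[THEN sym]) (metis UnI1 UnI2 int_cases2 rangeI)
  ultimately show ?thesis by simp
qed

text \<open>Quadratic decay beats any linear term in the exponent, so the norms are dominated by a
  constant multiple of \<open>exp (- \<bar>n\<bar>)\<close>.\<close>

lemma abs_summable_on_gaussian:
  fixes f :: "int \<Rightarrow> complex" and A B C :: real
  assumes "A > 0" and "\<And>n. norm (f n) = exp (- (A * of_int n ^ 2) + B * of_int n + C)"
  shows "f abs_summable_on UNIV"
proof -
  \<comment> \<open>\<open>D\<close> is the maximum over real \<open>t\<close> of
    \<open>- A * t\<^sup>2 + (\<bar>B\<bar> + 1) * t + C\<close>, found by completing the square.
    The extra 1 beside \<open>\<bar>B\<bar>\<close> is what leaves the factor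
    \<open>exp (- t)\<close> in the bound.\<close>
  define D where "D = (\<bar>B\<bar> + 1)\<^sup>2 / (4 * A) + C"
  have bound: "norm (f n) \<le> exp D * exp (- real_of_int \<bar>n\<bar>)" for n
  proof -
    define t where "t = real_of_int \<bar>n\<bar>"
    have "B * of_int n \<le> \<bar>B\<bar> * t"
      unfolding t_def by (metis abs_ge_self abs_mult of_int_abs)
    moreover have "(\<bar>B\<bar> + 1) * t \<le> A * t\<^sup>2 + (\<bar>B\<bar> + 1)\<^sup>2 / (4 * A)"
    proof -
      have "A * (t - (\<bar>B\<bar> + 1) / (2 * A))\<^sup>2 = A * t\<^sup>2 - (\<bar>B\<bar> + 1) * t + (\<bar>B\<bar> + 1)\<^sup>2 / (4 * A)"
        using assms(1) by (simp add: power2_diff power_divide field_simps power2_eq_square)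
      moreover have "0 \<le> A * (t - (\<bar>B\<bar> + 1) / (2 * A))\<^sup>2"
        using assms(1) by simp
      ultimately show ?thesis by linarith
    qed
    moreover have "t\<^sup>2 = (of_int n)\<^sup>2"
      by (simp add: t_def)
    ultimately have "- (A * of_int n ^ 2) + B * of_int n + C \<le> D - t"
      by (simp add: D_def algebra_simps)
    thus ?thesis
      by (simp add: assms(2) t_def flip: exp_add)
  qed
  have "(\<lambda>n::int. exp D * exp (- real_of_int \<bar>n\<bar>)) summable_on UNIV"
    by (intro summable_on_cmult_right summable_on_exp_minus_abs)
  hence "(\<lambda>n. norm (f n)) summable_on UNIV"
    using bound norm_ge_zero by (rule summable_on_comparison_test)
  thus ?thesis
    by (rule abs_summable_equivalent[THEN iffD1])
qed

section \<open>From powers of series to sums over tuples\<close>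

text \<open>Absolute convergence allows a finite product of series to be multiplied out, one tuple
  entry for each factor. For \<open>a = 0\<close> or \<open>b = 0\<close> the corresponding index
  set is the single empty tuple, and the empty product 1 matches the zeroth power.\<close>

lemma has_sum_power_mult_power:
  fixes f g :: "int \<Rightarrow> complex"
  assumes f: "f abs_summable_on UNIV" and g: "g abs_summable_on UNIV"
  shows "((\<lambda>(r, s). (\<Prod>j=1..a. f (r j)) * (\<Prod>j=1..b. g (s j))) has_sum
           (infsum f UNIV ^ a * infsum g UNIV ^ b))
         (({1..a::nat} \<rightarrow>\<^sub>E UNIV) \<times> ({1..b::nat} \<rightarrow>\<^sub>E UNIV))"
proof -
  let ?A = "{1..a} \<rightarrow>\<^sub>E (UNIV :: int set)" and ?B = "{1..b} \<rightarrow>\<^sub>E (UNIV :: int set)"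
  let ?F = "\<lambda>r. \<Prod>j=1..a. f (r j)" and ?G = "\<lambda>s. \<Prod>j=1..b. g (s j)"
  have count: "countable ?A" "countable ?B"
    by (auto intro: countable_PiE)
  have F: "?F abs_summable_on ?A" and G: "?G abs_summable_on ?B"
    by (rule abs_summable_on_prod_PiE; use f g in simp)+
  \<comment> \<open>The product rules are applied to \<open>infsetsum\<close>; absolute summability
    then identifies the values with those of \<open>infsum\<close>.\<close>
  have "infsetsum ?F ?A = infsetsum f UNIV ^ a" "infsetsum ?G ?B = infsetsum g UNIV ^ b"
    by (subst infsetsum_prod_PiE; use f g in simp)+
  hence "infsetsum (\<lambda>(r, s). ?F r * ?G s) (?A \<times> ?B) = infsetsum f UNIV ^ a * infsetsum g UNIV ^ b"
    using infsetsum_product[OF count F G] by simp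
  moreover have FG: "(\<lambda>(r, s). ?F r * ?G s) abs_summable_on (?A \<times> ?B)"
    by (rule abs_summable_on_product[OF count F G])
  ultimately have "infsum (\<lambda>(r, s). ?F r * ?G s) (?A \<times> ?B) = infsum f UNIV ^ a * infsum g UNIV ^ b"
    using f g by (simp add: infsetsum_infsum)
  moreover have "(\<lambda>(r, s). ?F r * ?G s) summable_on (?A \<times> ?B)"
    using FG abs_summable_equivalent abs_summable_summable by blast
  ultimately show ?thesis
    by (metis has_sum_infsum)
qed

section \<open>Finite averages and roots of unity\<close>

lemma has_sum_sum_finite:
  fixes f :: "'i \<Rightarrow> 'a \<Rightarrow> 'b :: topological_comm_monoid_add"
  assumes "\<And>i. i \<in> I \<Longrightarrow> (f i has_sum S i) A"
  shows "((\<lambda>x. \<Sum>i\<in>I. f i x) has_sum (\<Sum>i\<in>I. S i)) A"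
  using assms by (induction I rule: infinite_finite_induct) (auto intro: has_sum_add)

text \<open>The terms are the powers of an \<open>M\<close>-th root of unity \<open>w\<close>. The
  geometric sum vanishes unless \<open>w = 1\<close>, which happens exactly when \<open>M\<close>
  divides \<open>N\<close>.\<close>

lemma sum_exp_roots_of_unity:
  fixes M :: nat and N :: int
  assumes "M > 0"
  shows "(\<Sum>k<M. exp (\<i> * of_int (2 * N) * of_real (real k * pi / real M))) =
           (if int M dvd N then of_nat M else 0)"
proof -
  define w where "w = exp (\<i> * of_int (2 * N) * of_real (pi / real M))"
  have pow: "exp (\<i> * of_int (2 * N) * of_real (real k * pi / real M)) = w ^ k" for k
    by (simp add: w_def mult_ac flip: exp_of_nat_mult)
  have "w ^ M = exp (of_int (2 * N) * of_real pi * \<i>)"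
    using assms by (simp add: w_def mult_ac flip: exp_of_nat_mult)
  also have "\<dots> = 1"
    by (subst exp_eq_1) auto
  finally have wM: "w ^ M = 1" .
  have "w = 1 \<longleftrightarrow> (\<exists>p::int. real_of_int (2 * N) * (pi / real M) = of_int (2 * p) * pi)"
    by (simp add: w_def exp_eq_1)
  also have "\<dots> \<longleftrightarrow> (\<exists>p::int. real_of_int N = real_of_int (int M * p))"
    using assms by (intro ex_cong1) (simp add: field_simps)
  also have "\<dots> \<longleftrightarrow> int M dvd N"
    by (simp only: of_int_eq_iff dvd_def)
  finally have w1: "w = 1 \<longleftrightarrow> int M dvd N" .
  show ?thesis
  proof (cases "w = 1")
    case True
    with w1 show ?thesis by (simp only: pow) simp
  next
    case False
    with w1 wM show ?thesis by (simp only: pow sum_gp_strict) simp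
  qed
qed

section \<open>Expansion of a product of theta powers\<close>

lemma prod_theta1_terms:
  assumes "finite A"
  shows "(\<Prod>j\<in>A. (-1) powi r j * nome_pow \<tau> (of_int (r j * (r j + 1))) *
              exp (of_int (2 * r j + 1) * \<i> * w)) =
         (-1) powi (\<Sum>j\<in>A. r j) * nome_pow \<tau> (of_int ((\<Sum>j\<in>A. (r j)\<^sup>2) + (\<Sum>j\<in>A. r j))) *
           exp (of_int (2 * (\<Sum>j\<in>A. r j) + int (card A)) * \<i> * w)"
  using assms
proof (induction A rule: finite_induct)
  case (insert i A)
  have q: "real_of_int (r i * (r i + 1)) + of_int ((\<Sum>j\<in>A. (r j)\<^sup>2) + (\<Sum>j\<in>A. r j)) =
        of_int ((\<Sum>j\<in>insert i A. (r j)\<^sup>2) + (\<Sum>j\<in>insert i A. r j))"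
    using insert.hyps by (simp add: algebra_simps power2_eq_square)
  have e: "of_int (2 * r i + 1) * \<i> * w + of_int (2 * (\<Sum>j\<in>A. r j) + int (card A)) * \<i> * w =
        of_int (2 * (\<Sum>j\<in>insert i A. r j) + int (card (insert i A))) * \<i> * w"
    using insert.hyps by (simp add: algebra_simps)
  have s: "(-1::complex) powi (\<Sum>j\<in>insert i A. r j) = (-1) powi r i * (-1) powi (\<Sum>j\<in>A. r j)"
    using insert.hyps by (simp add: power_int_add)
  show ?case
    unfolding prod.insert[OF insert.hyps] insert.IH s
    unfolding q[symmetric] e[symmetric] nome_pow_add exp_add by (simp only: mult_ac)
qed simp

lemma prod_theta3_terms:
  assumes "finite A"
  shows "(\<Prod>j\<in>A. nome_pow \<tau> (of_int ((s j)\<^sup>2)) * exp (of_int (2 * s j) * \<i> * w)) =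
         nome_pow \<tau> (of_int (\<Sum>j\<in>A. (s j)\<^sup>2)) * exp (of_int (2 * (\<Sum>j\<in>A. s j)) * \<i> * w)"
  using assms
proof (induction A rule: finite_induct)
  case (insert i A)
  have e: "of_int (2 * s i) * \<i> * w + of_int (2 * (\<Sum>j\<in>A. s j)) * \<i> * w =
        of_int (2 * (\<Sum>j\<in>insert i A. s j)) * \<i> * w"
    using insert.hyps by (simp add: algebra_simps)
  show ?case
    unfolding prod.insert[OF insert.hyps] insert.IH e[symmetric] exp_add
    using insert.hyps by (simp add: nome_pow_add mult_ac)
qed simp

text \<open>The norm of the summand is the exponential of a real quadratic in \<open>n\<close> with
  leading coefficient \<open>- pi * Im \<tau>\<close>, which is negative in the upper
  half-plane.\<close>

lemma abs_summable_on_theta1_terms: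
  assumes "Im \<tau> > 0"
  shows "(\<lambda>n::int. (-1) powi n * nome_pow \<tau> (of_int (n * (n + 1))) *
            exp (of_int (2 * n + 1) * \<i> * w)) abs_summable_on UNIV"
proof (rule abs_summable_on_gaussian)
  show "pi * Im \<tau> > 0" using assms by simp
  show "norm ((-1) powi n * nome_pow \<tau> (of_int (n * (n + 1))) * exp (of_int (2 * n + 1) * \<i> * w)) =
     exp (- (pi * Im \<tau> * of_int n ^ 2) + (- (pi * Im \<tau>) - 2 * Im w) * of_int n + (- Im w))" for n
    by (simp add: norm_mult norm_power_int norm_nome_pow algebra_simps power2_eq_square
             flip: exp_add)
qed

lemma abs_summable_on_theta3_terms:
  assumes "Im \<tau> > 0"
  shows "(\<lambda>n::int. nome_pow \<tau> (of_int (n\<^sup>2)) * exp (of_int (2 * n) * \<i> * w)) abs_summable_on UNIV"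
proof (rule abs_summable_on_gaussian)
  show "pi * Im \<tau> > 0" using assms by simp
  show "norm (nome_pow \<tau> (of_int (n\<^sup>2)) * exp (of_int (2 * n) * \<i> * w)) =
     exp (- (pi * Im \<tau> * of_int n ^ 2) + (- 2 * Im w) * of_int n + 0)" for n
    by (simp add: norm_mult norm_nome_pow algebra_simps flip: exp_add)
qed

text \<open>The summand of \<open>R13\<close>, taken on all tuples: the expansion of the theta
  product also runs over tuples outside \<open>R13_index\<close>.\<close>

definition R13_summand ::
  "nat \<Rightarrow> nat \<Rightarrow> complex \<Rightarrow> complex \<Rightarrow> complex \<Rightarrow> (nat \<Rightarrow> int) \<times> (nat \<Rightarrow> int) \<Rightarrow> complex" where
  "R13_summand a b x y \<tau> = (\<lambda>(r, s).
        (-1) powi (\<Sum>j=1..a. r j) *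
        nome_pow \<tau> (of_int ((\<Sum>j=1..a. (r j)\<^sup>2) + (\<Sum>j=1..b. (s j)\<^sup>2) + (\<Sum>j=1..a. r j))) *
        exp (\<i> * (of_int (2 * (\<Sum>j=1..a. r j)) * x + of_int (2 * (\<Sum>j=1..b. s j)) * y
                  + of_nat a * x)))"

text \<open>For even \<open>a\<close> the division is exact, and this is half the coefficient of
  \<open>\<i> * z\<close> in the exponent that a tuple contributes. It vanishes exactly on the
  tuples of \<open>R13_index\<close>.\<close>

definition half_freq :: "nat \<Rightarrow> nat \<Rightarrow> (nat \<Rightarrow> int) \<times> (nat \<Rightarrow> int) \<Rightarrow> int" where
  "half_freq a b = (\<lambda>(r, s). (\<Sum>j=1..a. r j) + (\<Sum>j=1..b. s j) + int (a div 2))"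

lemma R13_index_eq:
  assumes "even a"
  shows "R13_index a b =
           {t \<in> ({1..a} \<rightarrow>\<^sub>E UNIV) \<times> ({1..b} \<rightarrow>\<^sub>E UNIV). half_freq a b t = 0}"
  using assms by (auto simp: R13_index_def half_freq_def elim!: evenE)

text \<open>Multiplying out the theta series and collecting exponents isolates the dependence on
  \<open>z\<close> in a single exponential, governed by \<open>half_freq\<close>. The remaining
  factor is the summand of \<open>R13\<close>.\<close>

lemma has_sum_theta1_power_mult_theta3_power:
  assumes "Im \<tau> > 0" and "even a"
  shows "((\<lambda>t. \<i> ^ a * nome_pow \<tau> (real a / 4) * (R13_summand a b x y \<tau> t *
              exp (\<i> * of_int (2 * half_freq a b t) * z))) has_sum
            (jtheta1 (z + x) \<tau> ^ a * jtheta3 (z + y) \<tau> ^ b))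
          (({1..a} \<rightarrow>\<^sub>E UNIV) \<times> ({1..b} \<rightarrow>\<^sub>E UNIV))"
proof -
  define f where "f = (\<lambda>n::int. (-1) powi n * nome_pow \<tau> (of_int (n * (n + 1))) *
            exp (of_int (2 * n + 1) * \<i> * (z + x)))"
  define g where "g = (\<lambda>n::int. nome_pow \<tau> (of_int (n\<^sup>2)) * exp (of_int (2 * n) * \<i> * (z + y)))"
  have summand: "(\<Prod>j=1..a. f (r j)) * (\<Prod>j=1..b. g (s j)) =
      R13_summand a b x y \<tau> (r, s) * exp (\<i> * of_int (2 * half_freq a b (r, s)) * z)" for r s
  proof -
    define R S Q P where "R = (\<Sum>j=1..a. r j)" and "S = (\<Sum>j=1..b. s j)"
      and "Q = (\<Sum>j=1..a. (r j)\<^sup>2)" and "P = (\<Sum>j=1..b. (s j)\<^sup>2)"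
    have q: "nome_pow \<tau> (of_int (Q + P + R)) = nome_pow \<tau> (of_int (Q + R)) * nome_pow \<tau> (of_int P)"
      by (simp add: add_ac flip: nome_pow_add)
    have h: "2 * half_freq a b (r, s) = 2 * R + 2 * S + int a"
      using assms(2) by (auto simp: half_freq_def R_def S_def elim!: evenE)
    have e: "exp (of_int (2 * R + int a) * \<i> * (z + x)) * exp (of_int (2 * S) * \<i> * (z + y)) =
        exp (\<i> * (of_int (2 * R) * x + of_int (2 * S) * y + of_nat a * x)) *
        exp (\<i> * of_int (2 * R + 2 * S + int a) * z)"
      by (simp add: algebra_simps flip: exp_add)
    have "(\<Prod>j=1..a. f (r j)) * (\<Prod>j=1..b. g (s j)) =
        (-1) powi R * nome_pow \<tau> (of_int (Q + R)) * nome_pow \<tau> (of_int P) *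
        (exp (of_int (2 * R + int a) * \<i> * (z + x)) * exp (of_int (2 * S) * \<i> * (z + y)))"
      unfolding f_def g_def prod_theta1_terms[OF finite_atLeastAtMost]
        prod_theta3_terms[OF finite_atLeastAtMost] R_def S_def Q_def P_def card_atLeastAtMost
        diff_Suc_1 by (simp only: mult_ac)
    also have "\<dots> = R13_summand a b x y \<tau> (r, s) * exp (\<i> * of_int (2 * half_freq a b (r, s)) * z)"
      unfolding R13_summand_def prod.case e h R_def[symmetric] S_def[symmetric] Q_def[symmetric]
        P_def[symmetric] q by (simp only: mult_ac)
    finally show ?thesis .
  qed
  \<comment> \<open>Evenness of \<open>a\<close> reconciles the prefactor \<open>- \<i>\<close> of
    \<open>jtheta1\<close> with the factor \<open>\<i> ^ a\<close> of \<open>R13\<close>.\<close>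
  have "(-\<i>) ^ a = \<i> ^ a"
    using assms(2) by simp
  hence "jtheta1 (z + x) \<tau> ^ a * jtheta3 (z + y) \<tau> ^ b =
      \<i> ^ a * nome_pow \<tau> (real a / 4) * (infsum f UNIV ^ a * infsum g UNIV ^ b)"
    unfolding jtheta1_def jtheta3_def f_def g_def
    by (simp only: power_mult_distrib nome_pow_power mult.assoc) simp
  moreover have "f abs_summable_on UNIV" "g abs_summable_on UNIV"
    unfolding f_def g_def
    using assms(1) by (rule abs_summable_on_theta1_terms abs_summable_on_theta3_terms)+
  from has_sum_cmult_right[OF has_sum_power_mult_power[OF this], of "\<i> ^ a * nome_pow \<tau> (real a / 4)"]
  have "((\<lambda>t. \<i> ^ a * nome_pow \<tau> (real a / 4) *
            (case t of (r, s) \<Rightarrow> (\<Prod>j=1..a. f (r j)) * (\<Prod>j=1..b. g (s j)))) has_sum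
          \<i> ^ a * nome_pow \<tau> (real a / 4) * (infsum f UNIV ^ a * infsum g UNIV ^ b))
        (({1..a} \<rightarrow>\<^sub>E UNIV) \<times> ({1..b} \<rightarrow>\<^sub>E UNIV))" .
  ultimately show ?thesis
    by (simp only: summand case_prod_unfold prod.collapse)
qed

section \<open>Shifts of tuples\<close>

text \<open>The restricted abstractions keep the shifted tuples extensional, hence inside the index
  sets.\<close>

definition shift_tuple ::
  "nat \<Rightarrow> nat \<Rightarrow> int \<Rightarrow> (nat \<Rightarrow> int) \<times> (nat \<Rightarrow> int) \<Rightarrow> (nat \<Rightarrow> int) \<times> (nat \<Rightarrow> int)" where
  "shift_tuple a b c = (\<lambda>(r, s). (\<lambda>j\<in>{1..a}. r j + c, \<lambda>j\<in>{1..b}. s j + c))"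

lemma shift_tuple_in:
  "shift_tuple a b c t \<in> ({1..a} \<rightarrow>\<^sub>E UNIV) \<times> ({1..b} \<rightarrow>\<^sub>E UNIV)"
  by (auto simp: shift_tuple_def split: prod.split)

text \<open>The condition \<open>c + d = 0\<close> lets a shift and its inverse cancel in either
  order.\<close>

lemma shift_tuple_uminus:
  assumes "t \<in> ({1..a} \<rightarrow>\<^sub>E UNIV) \<times> ({1..b} \<rightarrow>\<^sub>E UNIV)" and "c + d = 0"
  shows "shift_tuple a b c (shift_tuple a b d t) = t"
proof -
  obtain r s where t: "t = (r, s)" by (cases t)
  have "d = - c" using assms(2) by simp
  moreover have "(\<lambda>j\<in>{1..a}. r j) = r" "(\<lambda>j\<in>{1..b}. s j) = s"
    using assms(1) by (auto simp: t intro!: PiE_restrict simp flip: restrict_def)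
  ultimately show ?thesis
    by (simp add: shift_tuple_def t cong: restrict_cong)
qed

lemma half_freq_shift_tuple:
  "half_freq a b (shift_tuple a b c t) = half_freq a b t + int (a + b) * c"
  by (simp add: half_freq_def shift_tuple_def case_prod_unfold sum.distrib algebra_simps)

text \<open>The shift raises the exponent of the nome by \<open>(a + b) * c\<^sup>2\<close> plus
  \<open>c\<close> times twice the vanishing \<open>half_freq\<close>. It adds
  \<open>2 * c * (a * x + b * y) = 0\<close> inside the exponential, and the sign changes by
  \<open>(-1) powi (a * c) = 1\<close> since \<open>a\<close> is even.\<close>

lemma R13_summand_shift_tuple:
  assumes "even a" and "half_freq a b t = 0" and xy: "of_nat a * x + of_nat b * y = 0"
  shows "R13_summand a b x y \<tau> (shift_tuple a b c t) =
           R13_summand a b x y \<tau> t * nome_pow \<tau> (of_int (int (a + b) * c\<^sup>2))"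
proof -
  obtain r s where t: "t = (r, s)" by (cases t)
  define R S Q P where "R = (\<Sum>j=1..a. r j)" and "S = (\<Sum>j=1..b. s j)"
    and "Q = (\<Sum>j=1..a. (r j)\<^sup>2)" and "P = (\<Sum>j=1..b. (s j)\<^sup>2)"
  obtain u v where uv: "shift_tuple a b c t = (u, v)" by (cases "shift_tuple a b c t")
  have u: "(\<Sum>j=1..a. u j) = R + int a * c"
    and v: "(\<Sum>j=1..b. v j) = S + int b * c"
    and u2: "(\<Sum>j=1..a. (u j)\<^sup>2) = Q + 2 * c * R + int a * c\<^sup>2"
    and v2: "(\<Sum>j=1..b. (v j)\<^sup>2) = P + 2 * c * S + int b * c\<^sup>2"
    using uv by (auto simp: shift_tuple_def t R_def S_def Q_def P_def sum.distrib power2_sum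
                   sum_distrib_left mult_ac)
  have N: "2 * R + 2 * S + int a = 0"
    using assms(1,2) by (auto simp: half_freq_def t R_def S_def elim!: evenE)
  have "(Q + 2 * c * R + int a * c\<^sup>2) + (P + 2 * c * S + int b * c\<^sup>2) + (R + int a * c) =
      (Q + P + R) + int (a + b) * c\<^sup>2 + c * (2 * R + 2 * S + int a)"
    by (simp add: algebra_simps)
  hence q: "nome_pow \<tau> (of_int ((Q + 2 * c * R + int a * c\<^sup>2) + (P + 2 * c * S + int b * c\<^sup>2)
                 + (R + int a * c))) =
      nome_pow \<tau> (of_int (Q + P + R)) * nome_pow \<tau> (of_int (int (a + b) * c\<^sup>2))"
    unfolding N by (simp only: mult_zero_right add_0_right of_int_add nome_pow_add)
  have sgn: "(-1::complex) powi (R + int a * c) = (-1) powi R"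
    using assms(1) by (simp add: power_int_add power_int_mult)
  have "of_int (2 * (R + int a * c)) * x + of_int (2 * (S + int b * c)) * y + of_nat a * x =
      of_int (2 * R) * x + of_int (2 * S) * y + of_nat a * x +
      2 * of_int c * (of_nat a * x + of_nat b * y)"
    by (simp add: algebra_simps)
  hence e: "of_int (2 * (R + int a * c)) * x + of_int (2 * (S + int b * c)) * y + of_nat a * x =
      of_int (2 * R) * x + of_int (2 * S) * y + of_nat a * x"
    unfolding xy by simp
  show ?thesis
    unfolding uv unfolding t R13_summand_def prod.case u v u2 v2 q sgn e
    unfolding R_def[symmetric] S_def[symmetric] Q_def[symmetric] P_def[symmetric]
    by (simp only: mult_ac)
qed

text \<open>Shifting by \<open>m * p\<close> moves \<open>half_freq\<close> from 0 to
  \<open>m * (a + b) * p\<close>. So \<open>p\<close> is recovered by division, exact on the target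
  set, and the original tuple by shifting back.\<close>

lemma bij_betw_shift_tuple:
  assumes "even a" and "m > 0" and "a + b > 0"
  shows "bij_betw (\<lambda>(t, p). shift_tuple a b (int m * p) t) (R13_index a b \<times> UNIV)
           {t \<in> ({1..a} \<rightarrow>\<^sub>E UNIV) \<times> ({1..b} \<rightarrow>\<^sub>E UNIV). int (m * (a + b)) dvd half_freq a b t}"
proof -
  let ?T = "({1..a} \<rightarrow>\<^sub>E (UNIV :: int set)) \<times> ({1..b} \<rightarrow>\<^sub>E (UNIV :: int set))"
  define h where "h = (\<lambda>(t, p). shift_tuple a b (int m * p) t)"
  define P where "P t = half_freq a b t div int (m * (a + b))" for t
  define h' where "h' t = (shift_tuple a b (- (int m * P t)) t, P t)" for t
  have pos: "int (m * (a + b)) \<noteq> 0"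
    using assms by (simp del: of_nat_add)
  have freq: "half_freq a b (h (t, p)) = int (m * (a + b)) * p" if "t \<in> R13_index a b" for t p
    using that by (simp add: R13_index_eq[OF assms(1)] h_def half_freq_shift_tuple mult_ac)
  have inv1: "h' (h (t, p)) = (t, p)" if "t \<in> R13_index a b" for t p
  proof -
    have "P (h (t, p)) = p"
      unfolding P_def freq[OF that] using pos by (rule nonzero_mult_div_cancel_left)
    thus ?thesis
      using that unfolding h'_def by (simp add: R13_index_eq[OF assms(1)] h_def shift_tuple_uminus)
  qed
  have inv2: "h (h' t) = t" if "t \<in> ?T" for t
    using that by (simp add: h_def h'_def shift_tuple_uminus)
  have maps: "h (t, p) \<in> ?T" "int (m * (a + b)) dvd half_freq a b (h (t, p))"
    if "t \<in> R13_index a b" for t p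
    unfolding freq[OF that] unfolding h_def prod.case by (rule shift_tuple_in dvd_triv_left)+
  have maps': "h' t \<in> R13_index a b \<times> UNIV" if "int (m * (a + b)) dvd half_freq a b t" for t
  proof -
    have "half_freq a b t = int (m * (a + b)) * P t"
      using that unfolding P_def by simp
    hence "half_freq a b (shift_tuple a b (- (int m * P t)) t) = 0"
      unfolding half_freq_shift_tuple by simp
    thus ?thesis
      unfolding R13_index_eq[OF assms(1)] h'_def using shift_tuple_in by blast
  qed
  show ?thesis
    unfolding h_def[symmetric]
  proof (rule bij_betw_byWitness[where f' = h'])
    show "\<forall>tp\<in>R13_index a b \<times> UNIV. h' (h tp) = tp"
      using inv1 by blast
    show "\<forall>t\<in>{t \<in> ?T. int (m * (a + b)) dvd half_freq a b t}. h (h' t) = t"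
      using inv2 by blast
    show "h ` (R13_index a b \<times> UNIV) \<subseteq> {t \<in> ?T. int (m * (a + b)) dvd half_freq a b t}"
      using maps by blast
    show "h' ` {t \<in> ?T. int (m * (a + b)) dvd half_freq a b t} \<subseteq> R13_index a b \<times> UNIV"
      using maps' by blast
  qed
qed

section \<open>Averaging over \<open>k\<close> and factoring the resulting sum\<close>

theorem theorem3p10:
  fixes m n a b :: nat and x y \<tau> :: complex
  assumes "Im \<tau> > 0"
    and "m > 0" and "n > 0"
    and "a + b = n" and "even a"
    and "of_nat a * x + of_nat b * y = 0"
  shows "\<forall>z::complex.
    (\<Sum>k=0..<m * n.
       jtheta1 (z + x + of_real (real k * pi / real (m * n))) \<tau> ^ a *
       jtheta3 (z + y + of_real (real k * pi / real (m * n))) \<tau> ^ b)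
    = R13 a b x y m n \<tau> * jtheta3 (of_nat (m * n) * z) (of_nat (m\<^sup>2 * n) * \<tau>)"
proof
  fix z :: complex
  define T where "T = ({1..a} \<rightarrow>\<^sub>E (UNIV :: int set)) \<times> ({1..b} \<rightarrow>\<^sub>E (UNIV :: int set))"
  define D where "D = {t \<in> T. int (m * n) dvd half_freq a b t}"
  define C where "C = \<i> ^ a * nome_pow \<tau> (real a / 4)"
  define G where "G = R13_summand a b x y \<tau>"
  define E where "E = (\<lambda>t w. exp (\<i> * of_int (2 * half_freq a b t) * w))"
  define th where "th = (\<lambda>k. complex_of_real (real k * pi / real (m * n)))"
  define q3 where "q3 = (\<lambda>p::int. nome_pow (of_nat (m\<^sup>2 * n) * \<tau>) (of_int (p\<^sup>2)) *
                           exp (of_int (2 * p) * \<i> * (of_nat (m * n) * z)))"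
  define L where "L = (\<Sum>k=0..<m * n. jtheta1 (z + x + th k) \<tau> ^ a * jtheta3 (z + y + th k) \<tau> ^ b)"
  have mn: "m * n > 0" using assms by simp
  have "((\<lambda>t. C * (G t * E t (z + th k))) has_sum
           (jtheta1 (z + x + th k) \<tau> ^ a * jtheta3 (z + y + th k) \<tau> ^ b)) T" for k
    using has_sum_theta1_power_mult_theta3_power[OF assms(1,5), of b x y "z + th k"]
    by (simp only: C_def G_def E_def T_def add_ac)
  hence "((\<lambda>t. \<Sum>k=0..<m * n. C * (G t * E t (z + th k))) has_sum L) T"
    unfolding L_def by (intro has_sum_sum_finite)
  moreover have "(\<Sum>k=0..<m * n. C * (G t * E t (z + th k))) =
      (if int (m * n) dvd half_freq a b t then of_nat (m * n) * C * (G t * E t z) else 0)" for t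
  proof -
    \<comment> \<open>The exponential turns the sum \<open>z + th k\<close> into a product, so only
      a sum over roots of unity depends on \<open>k\<close>.\<close>
    have "(\<Sum>k=0..<m * n. C * (G t * E t (z + th k))) = C * (G t * E t z) * (\<Sum>k<m * n. E t (th k))"
      by (simp add: E_def ring_distribs exp_add sum_distrib_left mult_ac atLeast0LessThan)
    thus ?thesis
      unfolding E_def th_def sum_exp_roots_of_unity[OF mn] by simp
  qed
  ultimately have "((\<lambda>t. if int (m * n) dvd half_freq a b t
      then of_nat (m * n) * C * (G t * E t z) else 0) has_sum L) T"
    by simp
  \<comment> \<open>The terms outside \<open>D\<close> are zero, so the sum over \<open>T\<close>
    may be restricted to \<open>D\<close>.\<close>
  hence "((\<lambda>t. of_nat (m * n) * C * (G t * E t z)) has_sum L) D"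
    by (subst has_sum_cong_neutral[where T = T]) (auto simp: D_def)
  moreover have bij: "bij_betw (\<lambda>(t, p). shift_tuple a b (int m * p) t) (R13_index a b \<times> UNIV) D"
    unfolding D_def T_def assms(4)[symmetric]
    by (rule bij_betw_shift_tuple) (use assms in auto)
  ultimately have "((\<lambda>tp. of_nat (m * n) * C *
       (G (case tp of (t, p) \<Rightarrow> shift_tuple a b (int m * p) t) *
        E (case tp of (t, p) \<Rightarrow> shift_tuple a b (int m * p) t) z)) has_sum L) (R13_index a b \<times> UNIV)"
    by (subst has_sum_reindex_bij_betw[OF bij])
  moreover have "G (shift_tuple a b (int m * p) t) * E (shift_tuple a b (int m * p) t) z = G t * q3 p"
    if "t \<in> R13_index a b" for t p
  proof -
    have t: "half_freq a b t = 0"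
      using that by (simp add: R13_index_eq[OF assms(5)])
    \<comment> \<open>Regrouping \<open>n * (m * p)\<^sup>2 * \<tau>\<close> as
      \<open>p\<^sup>2 * (m\<^sup>2 * n * \<tau>)\<close> produces the new theta parameter.\<close>
    have "nome_pow \<tau> (of_int (int n * (int m * p)\<^sup>2)) =
        nome_pow (of_nat (m\<^sup>2 * n) * \<tau>) (of_int (p\<^sup>2))"
      by (simp add: nome_pow_def power_mult_distrib mult_ac)
    \<comment> \<open>The shifted tuple has \<open>half_freq\<close> equal to
      \<open>m * n * p\<close>, whence the new argument \<open>m * n * z\<close>.\<close>
    moreover have "E (shift_tuple a b (int m * p) t) z =
        exp (of_int (2 * p) * \<i> * (of_nat (m * n) * z))"
      by (simp only: E_def half_freq_shift_tuple t assms(4)) (simp add: mult_ac)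
    ultimately show ?thesis
      unfolding G_def q3_def R13_summand_shift_tuple[OF assms(5) t assms(6)] assms(4)
      by (simp only: mult_ac)
  qed
  ultimately have L: "((\<lambda>(t, p). of_nat (m * n) * C * (G t * q3 p)) has_sum L)
      (R13_index a b \<times> UNIV)"
    by (subst has_sum_cong[where g = "\<lambda>tp. of_nat (m * n) * C *
       (G (case tp of (t, p) \<Rightarrow> shift_tuple a b (int m * p) t) *
        E (case tp of (t, p) \<Rightarrow> shift_tuple a b (int m * p) t) z)"]) auto
  have "L = (\<Sum>\<^sub>\<infinity>(t, p)\<in>R13_index a b \<times> UNIV. of_nat (m * n) * C * (G t * q3 p))"
    using L by (simp add: infsumI)
  \<comment> \<open>Summability over the product set is contained in the fact \<open>L\<close>, and
    it justifies the iterated sum.\<close>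
  also have "\<dots> = (\<Sum>\<^sub>\<infinity>t\<in>R13_index a b. \<Sum>\<^sub>\<infinity>p. of_nat (m * n) * C * (G t * q3 p))"
    using L by (intro infsum_Sigma'_banach[symmetric]) (auto simp: summable_on_def)
  \<comment> \<open>Over a field, constant factors leave an \<open>infsum\<close> unconditionally,
    so the double sum splits without a separate convergence argument for \<open>G\<close> or
    \<open>q3\<close>.\<close>
  also have "\<dots> = of_nat (m * n) * C * (infsum G (R13_index a b) * infsum q3 UNIV)"
    by (simp only: infsum_cmult_right' infsum_cmult_left')
  also have "\<dots> = R13 a b x y m n \<tau> * jtheta3 (of_nat (m * n) * z) (of_nat (m\<^sup>2 * n) * \<tau>)"
    unfolding R13_def jtheta3_def q3_def C_def G_def R13_summand_def by (simp only: mult_ac)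
  finally show "(\<Sum>k=0..<m * n.
       jtheta1 (z + x + of_real (real k * pi / real (m * n))) \<tau> ^ a *
       jtheta3 (z + y + of_real (real k * pi / real (m * n))) \<tau> ^ b)
    = R13 a b x y m n \<tau> * jtheta3 (of_nat (m * n) * z) (of_nat (m\<^sup>2 * n) * \<tau>)"
    unfolding L_def th_def .
qed

end
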